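(* Let $(X,\tau)$ be a Hausdorff topological space, $k$ a positive integer, and $\Psi:X\to\,]-\infty,+\infty]$ a sequentially lower semicontinuous function such that, for some real $r>\inf_X\Psi$, the set $\overline{\Psi^{-1}(]-\infty,r[)}$ is compact and first-countable. Suppose that there are a function $\Phi:X\to\mathbf R$, bounded below in $\overline{\Psi^{-1}(]-\infty,r[)}$, and a sequence $\{\mu_n\}$ in $\mathbf R^+$ converging to $0$ such that, for each $\lambda>0$ small enough, the function $\Psi+\lambda\Phi$ is sequentially lower semicontinuous, and, for each $n\in\mathbf N$, the function $\Psi+\mu_n\Phi$ has at most $k$ $\tau_\Psi$-local minima lying in $\Psi^{-1}(]-\infty,r[)$. Then, for every $\rho\in\,]\inf_X\Psi,r]$, the sets $\overline{\Psi^{-1}(]-\infty,\rho[)}$ and $\Psi^{-1}(\inf_X\Psi)$ have at most $k$ connected components. So, in particular, these sets are connected when $k=1$.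
   Context: $\mathbf R^+=\,]0,+\infty[$. Closure, compactness, first-countability (of a subset, in its subspace topology), connectedness and sequential lower semicontinuity are with respect to $\tau$. For $\Psi:X\to\,]-\infty,+\infty]$ not identically $+\infty$, $\tau_\Psi$ denotes the smallest topology on $X$ containing both $\tau$ and the family of sets $\{\Psi^{-1}(]-\infty,s[)\}_{s\in\mathbf R}$. A $\tau_\Psi$-local minimum of a function $F$ on $X$ is a point $x\in X$ such that $F(x)\le F(y)$ for all $y$ in some $\tau_\Psi$-neighbourhood of $x$. "For each $\lambda>0$ small enough" means: there is $\lambda'>0$ such that the property holds for all $\lambda\in\,]0,\lambda']$. *)

theory Defs
  imports "HOL-Analysis.Analysis"
begin

definition seq_lower_semicontinuous :: "'a topology \<Rightarrow> ('a \<Rightarrow> ereal) \<Rightarrow> bool" where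
  "seq_lower_semicontinuous X F \<longleftrightarrow>
     (\<forall>\<sigma> x. range \<sigma> \<subseteq> topspace X \<and> limitin X \<sigma> x sequentially \<longrightarrow>
        F x \<le> liminf (\<lambda>n. F (\<sigma> n)))"

definition strict_sublevel :: "'a topology \<Rightarrow> ('a \<Rightarrow> ereal) \<Rightarrow> real \<Rightarrow> 'a set" where
  "strict_sublevel X F s = {x \<in> topspace X. F x < ereal s}"

definition sublevel_topology :: "'a topology \<Rightarrow> ('a \<Rightarrow> ereal) \<Rightarrow> 'a topology" where
  "sublevel_topology X F =
     topology_generated_by ({U. openin X U} \<union> range (strict_sublevel X F))"

definition local_minimum :: "'a topology \<Rightarrow> ('a \<Rightarrow> ereal) \<Rightarrow> 'a \<Rightarrow> bool" where
  "local_minimum T F x \<longleftrightarrow> (\<exists>U. openin T U \<and> x \<in> U \<and> (\<forall>y\<in>U. F x \<le> F y))"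

(* The finiteness conjunct is needed because card is 0 on infinite sets. *)
definition has_at_most :: "nat \<Rightarrow> 'a set \<Rightarrow> bool" where
  "has_at_most k S \<longleftrightarrow> finite S \<and> card S \<le> k"

end

theory Submission
  imports Defs
begin

text \<open>
  A space with more than \<open>k\<close> connected components splits into \<open>k + 1\<close> disjoint nonempty
  clopen pieces. Suppose that this happens to \<open>C\<close>, the closure of \<open>{\<Psi> < \<rho>}\<close>. Each piece
  \<open>U\<close> is open in \<open>C\<close>, so it contains a point \<open>a\<close> with \<open>\<Psi> a < \<rho>\<close>, and it is closed, so it is
  compact and the perturbed function \<open>\<Psi> + l \<Phi>\<close> attains its minimum over \<open>U\<close> at some point
  \<open>x\<close>. Since \<open>\<Phi>\<close> is bounded below, comparing the values at \<open>x\<close> and \<open>a\<close> gives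
  \<open>\<Psi> x \<le> \<Psi> a + l (\<Phi> a - inf \<Phi>)\<close>, which is less than \<open>\<rho>\<close> once \<open>l\<close> is small. The part of \<open>U\<close>
  where \<open>\<Psi> < \<rho>\<close> is open in the sublevel topology, so \<open>x\<close> is a local minimum for that topology
  (\<open>eventually_local_minimum_in_clopen_piece\<close>). For a late term \<open>l = \<mu> n\<close> this works in all
  pieces at once and yields \<open>k + 1\<close> different local minima, too many
  (\<open>card_open_partition_le_local_minima\<close>).

  The set of minimizers is the intersection of these closures as \<open>\<rho>\<close> decreases to the infimum.
  If it splits into \<open>k + 1\<close> clopen pieces, these are compact and can be separated by disjoint open
  sets; by compactness these sets cover the closure of \<open>{\<Psi> < \<rho>}\<close> for some \<open>\<rho>\<close> above the
  infimum, which therefore splits into \<open>k + 1\<close> clopen pieces too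
  (\<open>open_partition_extends_to_sublevel\<close>), and the first part applies.

  Semicontinuity is only sequential, so compactness has to be used through sequences; the first
  countability of the compact set makes this possible.
\<close>

section \<open>Sequences in first countable compact sets\<close>

lemma first_countable_nested_base:
  assumes "first_countable Y" "x \<in> topspace Y"
  shows "\<exists>B :: nat \<Rightarrow> 'a set. decseq B \<and> (\<forall>n. openin Y (B n) \<and> x \<in> B n) \<and>
    (\<forall>U. openin Y U \<and> x \<in> U \<longrightarrow> (\<exists>n. B n \<subseteq> U))"
proof -
  obtain \<B> where \<B>: "countable \<B>" "\<And>V. V \<in> \<B> \<Longrightarrow> openin Y V"
      "\<And>U. openin Y U \<Longrightarrow> x \<in> U \<Longrightarrow> \<exists>V\<in>\<B>. x \<in> V \<and> V \<subseteq> U"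
    using assms unfolding first_countable_def by metis
  define \<B>' where "\<B>' = {V \<in> \<B>. x \<in> V}"
  have ne: "\<B>' \<noteq> {}"
    using \<B>(3)[OF openin_topspace assms(2)] by (auto simp: \<B>'_def)
  have cnt: "countable \<B>'"
    using \<B>(1) by (simp add: \<B>'_def)
  define B where "B n = (\<Inter>i\<le>n. from_nat_into \<B>' i)" for n :: nat
  have mem: "from_nat_into \<B>' i \<in> \<B>'" for i
    using ne by (rule from_nat_into)
  have "openin Y (B n)" for n
    unfolding B_def using mem \<B>(2) by (intro openin_INT2) (auto simp: \<B>'_def)
  moreover have "x \<in> B n" for n
    using mem by (auto simp: B_def \<B>'_def)
  moreover have "decseq B"
    by (force simp: B_def decseq_def)
  moreover have "\<exists>n. B n \<subseteq> U" if "openin Y U" "x \<in> U" for U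
  proof -
    obtain V where V: "V \<in> \<B>'" "V \<subseteq> U"
      using \<B>(3)[OF \<open>openin Y U\<close> \<open>x \<in> U\<close>] by (auto simp: \<B>'_def)
    then obtain i where "V = from_nat_into \<B>' i"
      using from_nat_into_surj[OF cnt] by metis
    then have "B i \<subseteq> V" by (auto simp: B_def)
    then show ?thesis using V(2) by blast
  qed
  ultimately show ?thesis by blast
qed

text \<open>
  Letting the set vary with the index covers two uses at once: the constant family gives points of
  a closure as limits of sequences, and the tails of a sequence give convergent subsequences.
\<close>

lemma limit_of_selection_from_closures:
  assumes "first_countable (subtopology X K)" "x \<in> K"
    and AK: "\<And>n::nat. A n \<subseteq> K" and cl: "\<And>n. x \<in> X closure_of A n"
  obtains \<sigma> where "\<And>n. \<sigma> n \<in> A n" "limitin X \<sigma> x sequentially"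
proof -
  have xX: "x \<in> topspace X"
    using cl[of 0] by (simp add: in_closure_of)
  then have xK: "x \<in> topspace (subtopology X K)"
    using \<open>x \<in> K\<close> by simp
  obtain B :: "nat \<Rightarrow> 'a set" where B: "decseq B"
      "\<forall>n. openin (subtopology X K) (B n) \<and> x \<in> B n"
      "\<forall>U. openin (subtopology X K) U \<and> x \<in> U \<longrightarrow> (\<exists>n. B n \<subseteq> U)"
    using first_countable_nested_base[OF assms(1) xK] by blast
  have "\<exists>y. y \<in> A n \<inter> B n" for n :: nat
  proof -
    obtain T where T: "openin X T" "B n = T \<inter> K"
      using B(2) by (auto simp: openin_subtopology)
    then show ?thesis
      using cl[of n] B(2) AK[of n] unfolding in_closure_of by blast
  qed
  then obtain \<sigma> where \<sigma>: "\<And>n. \<sigma> n \<in> A n \<inter> B n" by metis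
  show thesis
  proof
    show "\<sigma> n \<in> A n" for n using \<sigma> by blast
    show "limitin X \<sigma> x sequentially"
      unfolding limitin_sequentially
    proof (intro conjI xX allI impI)
      fix U assume U: "openin X U \<and> x \<in> U"
      then obtain N where "B N \<subseteq> U \<inter> K"
        using B(3)[rule_format, of "U \<inter> K"] \<open>x \<in> K\<close> by (auto simp: openin_subtopology)
      then show "\<exists>N. \<forall>n. N \<le> n \<longrightarrow> \<sigma> n \<in> U"
        using \<sigma> decseqD[OF B(1)] by blast
    qed
  qed
qed

text \<open>
  The nested closures of the tails have a common point, and a selection from the tails converges to
  it. The index function \<open>f\<close> obtained this way need not be strictly increasing; tending to
  infinity is enough to transport limits along it.
\<close>

lemma compact_first_countable_subsequence:
  assumes K: "compactin X K" "first_countable (subtopology X K)"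
    and \<sigma>: "\<And>n::nat. \<sigma> n \<in> K"
  obtains x f where "x \<in> K" "filterlim f sequentially sequentially"
    "limitin X (\<lambda>n. \<sigma> (f n)) x sequentially"
proof -
  let ?Y = "subtopology X K"
  have KX: "K \<subseteq> topspace X" and comp: "compact_space ?Y"
    using K(1) by (auto simp: compactin_subspace)
  have "(\<Inter>n. ?Y closure_of (\<sigma> ` {n..})) \<noteq> {}"
  proof (rule compact_space_imp_nest[OF comp])
    show "?Y closure_of (\<sigma> ` {n..}) \<noteq> {}" for n
      using closure_of_subset[of "\<sigma> ` {n..}" ?Y] \<sigma> KX by force
    show "decseq (\<lambda>n. ?Y closure_of (\<sigma> ` {n..}))"
      by (intro decseq_SucI closure_of_mono) auto
  qed auto
  then obtain x where x: "\<And>n. x \<in> ?Y closure_of (\<sigma> ` {n..})" by blast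
  have "x \<in> K"
    using x[of 0] by (simp add: in_closure_of)
  have "x \<in> X closure_of (\<sigma> ` {n..})" for n
    using x[of n] by (simp add: closure_of_subtopology in_closure_of) blast
  then obtain \<tau> where \<tau>: "\<And>n. \<tau> n \<in> \<sigma> ` {n..}" "limitin X \<tau> x sequentially"
    using limit_of_selection_from_closures[OF K(2) \<open>x \<in> K\<close>, of "\<lambda>n. \<sigma> ` {n..}"] \<sigma> by blast
  then obtain f where f: "\<And>n. n \<le> f n" "\<tau> = (\<lambda>n. \<sigma> (f n))"
    unfolding fun_eq_iff image_iff by (metis atLeast_iff)
  have "filterlim f sequentially sequentially"
    by (rule filterlim_at_top_mono[OF filterlim_ident]) (simp add: f)
  then show thesis
    using \<tau>(2) unfolding f(2) by (rule that[OF \<open>x \<in> K\<close>])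
qed

section \<open>Sequentially lower semicontinuous functions\<close>

lemma seq_lsc_le_liminf:
  assumes "seq_lower_semicontinuous X F" "limitin X \<sigma> x sequentially"
    and "\<And>n. \<sigma> n \<in> topspace X"
  shows "F x \<le> liminf (\<lambda>n. F (\<sigma> n))"
proof -
  have "range \<sigma> \<subseteq> topspace X" using assms(3) by (rule image_subsetI)
  then show ?thesis
    by (rule assms(1)[unfolded seq_lower_semicontinuous_def, rule_format, OF conjI[OF _ assms(2)]])
qed

text \<open>
  The direct method: a subsequence of a minimizing sequence converges, and lower semicontinuity
  bounds the value at its limit by the infimum.
\<close>

lemma seq_lsc_attains_minimum:
  assumes K: "compactin X K" "first_countable (subtopology X K)" "K \<noteq> {}"
    and F: "seq_lower_semicontinuous X F"
  obtains x where "x \<in> K" "\<And>y. y \<in> K \<Longrightarrow> F x \<le> F y"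
proof -
  have KX: "K \<subseteq> topspace X" using K(1) by (rule compactin_subset_topspace)
  obtain u where u: "\<And>n::nat. u n \<in> F ` K" "u \<longlonglongrightarrow> Inf (F ` K)"
    using Inf_as_limit[of "F ` K"] K(3) by auto
  then obtain \<sigma> where \<sigma>: "\<And>n. \<sigma> n \<in> K" "u = (\<lambda>n. F (\<sigma> n))"
    unfolding fun_eq_iff image_iff by metis
  obtain x f where x: "x \<in> K" and f: "filterlim f sequentially sequentially"
    and lim: "limitin X (\<lambda>n. \<sigma> (f n)) x sequentially"
    using compact_first_countable_subsequence[OF K(1,2) \<sigma>(1)] .
  have "F x \<le> liminf (\<lambda>n. F (\<sigma> (f n)))"
    using \<sigma>(1) KX by (intro seq_lsc_le_liminf[OF F lim]) blast
  also have "\<dots> = Inf (F ` K)"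
    using filterlim_compose[OF u(2) f] by (intro lim_imp_Liminf) (auto simp: \<sigma>(2))
  finally have "F x \<le> F y" if "y \<in> K" for y
    using Inf_lower[OF imageI[OF that]] order_trans by blast
  then show thesis by (rule that[OF x])
qed

lemma seq_lsc_le_on_closure:
  assumes "first_countable (subtopology X K)" "closedin X K" "S \<subseteq> K"
    and F: "seq_lower_semicontinuous X F"
    and le: "\<And>y. y \<in> S \<Longrightarrow> F y \<le> c" and x: "x \<in> X closure_of S"
  shows "F x \<le> c"
proof -
  have "x \<in> K"
    using closure_of_minimal[OF \<open>S \<subseteq> K\<close> \<open>closedin X K\<close>] x by blast
  then obtain \<sigma> where \<sigma>: "\<And>n::nat. \<sigma> n \<in> S" "limitin X \<sigma> x sequentially"
    using limit_of_selection_from_closures[OF assms(1) \<open>x \<in> K\<close>, of "\<lambda>_. S"] x \<open>S \<subseteq> K\<close>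
    by blast
  have "F x \<le> liminf (\<lambda>n. F (\<sigma> n))"
    using \<sigma>(1) \<open>S \<subseteq> K\<close> closedin_subset[OF \<open>closedin X K\<close>]
    by (intro seq_lsc_le_liminf[OF F \<sigma>(2)]) blast
  also have "\<dots> \<le> liminf (\<lambda>_::nat. c)"
    using \<sigma>(1) le by (intro Liminf_mono) auto
  also have "\<dots> = c" by (simp add: Liminf_const)
  finally show ?thesis .
qed

section \<open>Counting components by clopen partitions\<close>

definition open_partition :: "'a topology \<Rightarrow> 'a set set \<Rightarrow> bool" where
  "open_partition Y P \<longleftrightarrow>
     finite P \<and> \<Union>P = topspace Y \<and> disjoint P \<and> (\<forall>U\<in>P. openin Y U \<and> U \<noteq> {})"

lemma open_partition_clopen:
  assumes "open_partition Y P" "U \<in> P"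
  shows "closedin Y U"
proof -
  have un: "\<Union>P = topspace Y" and "disjoint P"
    using assms(1) by (auto simp: open_partition_def)
  then have "W \<inter> U = {}" if "W \<in> P - {U}" for W
    using that assms(2) by (auto simp: disjoint_def)
  then have "U = topspace Y - \<Union>(P - {U})"
    unfolding un[symmetric] using assms(2) by blast
  moreover have "openin Y (\<Union>(P - {U}))"
    using assms by (auto simp: open_partition_def)
  ultimately show ?thesis by (metis closedin_diff closedin_topspace)
qed

text \<open>
  Each component is the one of the chosen point of a piece that it meets, so the pieces
  enumerate the components.
\<close>

lemma components_at_most_if_connected_partition:
  assumes P: "open_partition Y P" and conn: "\<And>U. U \<in> P \<Longrightarrow> connectedin Y U"
  shows "has_at_most (card P) (connected_components_of Y)"
proof -
  let ?c = "\<lambda>U. connected_component_of_set Y (SOME x. x \<in> U)"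
  have fin: "finite P" using P by (simp add: open_partition_def)
  have "connected_components_of Y \<subseteq> ?c ` P"
  proof
    fix C assume "C \<in> connected_components_of Y"
    then obtain x where x: "x \<in> topspace Y" "C = connected_component_of_set Y x"
      by (auto simp: connected_components_of_def)
    then obtain U where U: "U \<in> P" "x \<in> U"
      using P by (auto simp: open_partition_def)
    then have "(SOME x. x \<in> U) \<in> U" by (metis someI)
    then have "connected_component_of Y x (SOME x. x \<in> U)"
      using conn U by (auto simp: connected_component_of_def)
    then have "C = ?c U"
      using connected_component_of_equiv[of Y x "SOME x. x \<in> U"] x(2) by simp
    then show "C \<in> ?c ` P" using U(1) by blast
  qed
  then show ?thesis
    unfolding has_at_most_def using fin
    by (meson card_image_le card_mono finite_imageI finite_subset order_trans)
qed

lemma open_partition_refine: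
  assumes P: "open_partition Y P" and "U \<in> P" "\<not> connectedin Y U"
  obtains Q where "open_partition Y Q" "card Q = Suc (card P)"
proof -
  have U: "openin Y U" "closedin Y U" "U \<subseteq> topspace Y"
    using P \<open>U \<in> P\<close> open_partition_clopen[OF P \<open>U \<in> P\<close>]
    by (auto simp: open_partition_def openin_subset)
  then have "\<not> connected_space (subtopology Y U)"
    using assms(3) by (simp add: connectedin_def)
  then obtain A where A: "openin (subtopology Y U) A" "closedin (subtopology Y U) A"
      "A \<noteq> {}" "A \<noteq> topspace (subtopology Y U)"
    unfolding connected_space_clopen_in by blast
  define B where "B = U - A"
  have AU: "A \<subseteq> U" using openin_subset[OF A(1)] by simp
  have opA: "openin Y A" using A(1) U(1) by (metis openin_trans_full)
  have clA: "closedin Y A" using A(2) U(2) by (metis closedin_trans_full)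
  have opB: "openin Y B" unfolding B_def using U(1) clA by (rule openin_diff)
  have Bne: "B \<noteq> {}" using A(4) AU U(3) by (auto simp: B_def)
  have fin: "finite P" and disj: "disjoint P" and un: "\<Union>P = topspace Y"
    using P by (auto simp: open_partition_def)
  have away: "W \<inter> U = {}" if "W \<in> P - {U}" for W
    using disj that \<open>U \<in> P\<close> by (auto simp: disjoint_def)
  define Q where "Q = insert A (insert B (P - {U}))"
  have "A \<noteq> B" using A(3) by (auto simp: B_def)
  have "A \<notin> P - {U}" "B \<notin> P - {U}"
    using away A(3) AU Bne unfolding B_def by blast+
  then have "card Q = Suc (Suc (card (P - {U})))"
    using fin \<open>A \<noteq> B\<close> by (simp add: Q_def)
  then have card: "card Q = Suc (card P)"
    using card.remove[OF fin \<open>U \<in> P\<close>] by simp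
  have "disjoint (P - {U})"
    using disj by (rule pairwise_subset) blast
  moreover have "disjnt A W \<and> disjnt W A \<and> disjnt B W \<and> disjnt W B" if "W \<in> P - {U}" for W
    using away[OF that] AU by (auto simp: disjnt_def B_def)
  moreover have "disjnt A B \<and> disjnt B A" by (auto simp: disjnt_def B_def)
  ultimately have "disjoint Q"
    unfolding Q_def by (auto simp: pairwise_insert)
  moreover have "\<Union>Q = topspace Y"
    using un \<open>U \<in> P\<close> AU by (auto simp: Q_def B_def)
  ultimately have "open_partition Y Q"
    using P opA opB A(3) Bne by (auto simp: open_partition_def Q_def)
  then show thesis using that card by blast
qed

text \<open>
  Starting from the trivial partition, some piece can be split as long as there are at most \<open>k\<close> of
  them: otherwise all are connected and there are at most \<open>k\<close> components. The components
  themselves need not be open, so they cannot serve as the pieces.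
\<close>

lemma many_components_imp_open_partition:
  assumes "\<not> has_at_most k (connected_components_of Y)"
  obtains P where "open_partition Y P" "card P = Suc k"
proof -
  have "n \<le> k \<Longrightarrow> \<exists>P. open_partition Y P \<and> card P = Suc n" for n
  proof (induction n)
    case 0
    have "topspace Y \<noteq> {}"
      using assms by (auto simp: has_at_most_def connected_components_of_def)
    then have "open_partition Y {topspace Y}"
      by (simp add: open_partition_def)
    then show ?case by (intro exI[of _ "{topspace Y}"]) simp
  next
    case (Suc n)
    then obtain P where P: "open_partition Y P" "card P = Suc n" by auto
    have "\<exists>U\<in>P. \<not> connectedin Y U"
      using components_at_most_if_connected_partition[OF P(1)] P(2) Suc.prems assms
      by (metis has_at_most_def order_trans)
    then show ?case
      using open_partition_refine[OF P(1)] P(2) by metis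
  qed
  then show thesis using that by blast
qed

lemma has_at_most_one_component_imp_connectedin:
  assumes "S \<subseteq> topspace X" "has_at_most 1 (connected_components_of (subtopology X S))"
  shows "connectedin X S"
proof -
  let ?C = "connected_components_of (subtopology X S)"
  have "finite ?C" "card ?C \<le> Suc 0" using assms(2) by (auto simp: has_at_most_def)
  then have "connected_space (subtopology X S)"
    unfolding connected_space_iff_components_eq using card_le_Suc0_iff_eq by blast
  then show ?thesis using assms(1) by (simp add: connectedin_def)
qed

section \<open>Clopen partitions extend to slightly larger sublevel sets\<close>

text \<open>
  Separating each piece from the union of the others gives pairs \<open>A U\<close>, \<open>B U\<close>; cutting \<open>A U\<close> down
  to all the other \<open>B W\<close> makes the neighbourhoods pairwise disjoint.
\<close>

lemma finite_compact_family_separation: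
  assumes "Hausdorff_space X" "finite P" "disjoint P" and comp: "\<And>U. U \<in> P \<Longrightarrow> compactin X U"
  obtains V where "\<And>U. U \<in> P \<Longrightarrow> openin X (V U)" "\<And>U. U \<in> P \<Longrightarrow> U \<subseteq> V U"
    "\<And>U W. U \<in> P \<Longrightarrow> W \<in> P \<Longrightarrow> U \<noteq> W \<Longrightarrow> V U \<inter> V W = {}"
proof -
  have "\<exists>A B. openin X A \<and> openin X B \<and> U \<subseteq> A \<and> \<Union>(P - {U}) \<subseteq> B \<and> A \<inter> B = {}"
    if U: "U \<in> P" for U
  proof -
    have "compactin X (\<Union>(P - {U}))"
      using \<open>finite P\<close> comp by (intro compactin_Union) auto
    moreover have "disjnt U (\<Union>(P - {U}))"
      using \<open>disjoint P\<close> U by (auto simp: disjoint_def disjnt_def)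
    ultimately show ?thesis
      using Hausdorff_space_compact_separation[OF assms(1) comp[OF U]]
      by (metis disjnt_def)
  qed
  then obtain A B where AB: "\<And>U. U \<in> P \<Longrightarrow> openin X (A U)" "\<And>U. U \<in> P \<Longrightarrow> openin X (B U)"
      "\<And>U. U \<in> P \<Longrightarrow> U \<subseteq> A U" "\<And>U. U \<in> P \<Longrightarrow> \<Union>(P - {U}) \<subseteq> B U"
      "\<And>U. U \<in> P \<Longrightarrow> A U \<inter> B U = {}"
    by metis
  define V where "V U = \<Inter>(insert (A U) (B ` (P - {U})))" for U
  show thesis
  proof
    show "openin X (V U)" if "U \<in> P" for U
      unfolding V_def using AB(1,2) that \<open>finite P\<close> by (intro openin_Inter) auto
    show "U \<subseteq> V U" if "U \<in> P" for U
      using AB(3,4) that unfolding V_def by blast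
    show "V U \<inter> V W = {}" if "U \<in> P" "W \<in> P" "U \<noteq> W" for U W
      using AB(5)[of W] that unfolding V_def by blast
  qed
qed

text \<open>
  The pieces are enlarged to disjoint open sets with union \<open>N\<close>. If the closure of
  \<open>{\<Psi> < \<rho>}\<close> stuck out of \<open>N\<close> for all \<open>\<rho>\<close> close to \<open>m\<close>, points outside \<open>N\<close> with values tending to at most \<open>m\<close> would
  accumulate at a point outside \<open>N\<close> of value at most \<open>m\<close>, although \<open>N\<close> contains all of these.
\<close>

lemma open_partition_extends_to_sublevel:
  assumes T2: "Hausdorff_space X" and lsc: "seq_lower_semicontinuous X \<Psi>" and "m < r"
    and K: "compactin X (X closure_of strict_sublevel X \<Psi> r)"
      "first_countable (subtopology X (X closure_of strict_sublevel X \<Psi> r))"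
    and P: "open_partition (subtopology X {x \<in> topspace X. \<Psi> x \<le> ereal m}) P"
  obtains \<rho> Q where "m < \<rho>" "\<rho> \<le> r" "card Q = card P"
    "open_partition (subtopology X (X closure_of strict_sublevel X \<Psi> \<rho>)) Q"
proof -
  let ?K = "X closure_of strict_sublevel X \<Psi> r"
  let ?M = "{x \<in> topspace X. \<Psi> x \<le> ereal m}"
  have S_sub: "strict_sublevel X \<Psi> s \<subseteq> X closure_of strict_sublevel X \<Psi> s" for s
    by (rule closure_of_subset) (auto simp: strict_sublevel_def)
  have M_sub: "?M \<subseteq> X closure_of strict_sublevel X \<Psi> s" if "m < s" for s
  proof -
    have "?M \<subseteq> strict_sublevel X \<Psi> s"
      using that by (auto simp: strict_sublevel_def intro: le_less_trans)
    then show ?thesis using S_sub[of s] by blast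
  qed
  have "closedin X ?M"
  proof -
    have "\<Psi> x \<le> ereal m" if "x \<in> X closure_of ?M" for x
      using seq_lsc_le_on_closure[OF K(2) closedin_closure_of M_sub[OF \<open>m < r\<close>] lsc _ that]
      by blast
    then have "X closure_of ?M \<subseteq> ?M"
      using closure_of_subset_topspace[of X ?M] by blast
    moreover have "?M \<subseteq> topspace X" by blast
    ultimately show ?thesis using closure_of_subset_eq by blast
  qed
  have fin: "finite P" and disj: "disjoint P" and un: "\<Union>P = ?M"
    using P by (auto simp: open_partition_def)
  have "compactin X U" if "U \<in> P" for U
  proof (rule closed_compactin[OF K(1)])
    show "U \<subseteq> ?K" using un that M_sub[OF \<open>m < r\<close>] by blast
    show "closedin X U"
      using open_partition_clopen[OF P that] \<open>closedin X ?M\<close> by (rule closedin_trans_full)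
  qed
  then obtain V where V: "\<And>U. U \<in> P \<Longrightarrow> openin X (V U)" "\<And>U. U \<in> P \<Longrightarrow> U \<subseteq> V U"
      "\<And>U W. U \<in> P \<Longrightarrow> W \<in> P \<Longrightarrow> U \<noteq> W \<Longrightarrow> V U \<inter> V W = {}"
    using finite_compact_family_separation[OF T2 fin disj] by metis
  define N where "N = (\<Union>U\<in>P. V U)"
  have N: "openin X N" "?M \<subseteq> N"
    using V(1,2) unfolding un[symmetric] N_def by blast+
  define \<rho> where "\<rho> n = m + (r - m) / real (Suc n)" for n
  have \<rho>: "m < \<rho> n" "\<rho> n \<le> r" for n
    using \<open>m < r\<close> by (auto simp: \<rho>_def field_simps mult_right_mono)
  have \<rho>_lim: "\<rho> \<longlonglongrightarrow> m"
  proof -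
    have "(\<lambda>n. m + (r - m) * inverse (real (Suc n))) \<longlonglongrightarrow> m + (r - m) * 0"
      by (intro tendsto_intros LIMSEQ_inverse_real_of_nat)
    then show ?thesis by (simp add: \<rho>_def[abs_def] divide_inverse)
  qed
  have "\<exists>n. X closure_of strict_sublevel X \<Psi> (\<rho> n) \<subseteq> N"
  proof (rule ccontr)
    assume "\<not> ?thesis"
    then have "\<forall>n. \<exists>y. y \<in> X closure_of strict_sublevel X \<Psi> (\<rho> n) \<and> y \<notin> N"
      by blast
    then obtain \<sigma> where \<sigma>: "\<And>n. \<sigma> n \<in> X closure_of strict_sublevel X \<Psi> (\<rho> n)" "\<And>n. \<sigma> n \<notin> N"
      by metis
    have sub_r: "strict_sublevel X \<Psi> (\<rho> n) \<subseteq> strict_sublevel X \<Psi> r" for n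
      using \<rho>(2)[of n] by (auto simp: strict_sublevel_def intro: less_le_trans)
    then have \<sigma>K: "\<sigma> n \<in> ?K" for n
      using \<sigma>(1)[of n] closure_of_mono by blast
    have \<sigma>_le: "\<Psi> (\<sigma> n) \<le> ereal (\<rho> n)" for n
      by (rule seq_lsc_le_on_closure[OF K(2) closedin_closure_of _ lsc _ \<sigma>(1)[of n]])
        (use sub_r[of n] S_sub[of r] in \<open>auto simp: strict_sublevel_def\<close>)
    obtain x f where x: "x \<in> ?K" and f: "filterlim f sequentially sequentially"
      and lim: "limitin X (\<lambda>n. \<sigma> (f n)) x sequentially"
      using compact_first_countable_subsequence[OF K \<sigma>K] .
    have xX: "x \<in> topspace X" using lim by (rule limitin_topspace)
    have \<sigma>X: "\<sigma> n \<in> topspace X" for n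
      using \<sigma>K[of n] by (simp add: in_closure_of)
    have "x \<in> topspace X - N"
      using lim by (rule limitin_closedin) (use N(1) \<sigma>(2) \<sigma>X in auto)
    have "\<Psi> x \<le> liminf (\<lambda>n. \<Psi> (\<sigma> (f n)))"
      using lsc lim \<sigma>X by (rule seq_lsc_le_liminf)
    also have "\<dots> \<le> liminf (\<lambda>n. ereal (\<rho> (f n)))"
      using \<sigma>_le by (intro Liminf_mono) auto
    also have "\<dots> = ereal m"
      using filterlim_compose[OF \<rho>_lim f] by (intro lim_imp_Liminf) auto
    finally have "x \<in> N" using xX N(2) by blast
    then show False using \<open>x \<in> topspace X - N\<close> by blast
  qed
  then obtain n where n: "X closure_of strict_sublevel X \<Psi> (\<rho> n) \<subseteq> N" by blast
  let ?C = "X closure_of strict_sublevel X \<Psi> (\<rho> n)"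
  have ne: "V U \<inter> ?C \<noteq> {}" if "U \<in> P" for U
  proof -
    have "U \<noteq> {}" using P that by (simp add: open_partition_def)
    moreover have "U \<subseteq> ?C" using un that M_sub[OF \<rho>(1)[of n]] by blast
    ultimately show ?thesis using V(2)[OF that] by blast
  qed
  have inj: "inj_on (\<lambda>U. V U \<inter> ?C) P"
    using ne V(3) by (intro inj_onI) blast
  have "open_partition (subtopology X ?C) ((\<lambda>U. V U \<inter> ?C) ` P)"
    unfolding open_partition_def
  proof (intro conjI ballI)
    show "\<Union>((\<lambda>U. V U \<inter> ?C) ` P) = topspace (subtopology X ?C)"
      using n closure_of_subset_topspace[of X] by (auto simp: N_def)
    show "disjoint ((\<lambda>U. V U \<inter> ?C) ` P)"
      unfolding disjoint_def using V(3) by blast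
  qed (use fin ne V(1) in \<open>auto simp: openin_subtopology\<close>)
  then show thesis
    using that[OF \<rho>] card_image[OF inj] by blast
qed

section \<open>Clopen pieces of a sublevel set contain local minima\<close>

text \<open>
  The minimum of the perturbed function over the piece is the required point. That it lies in the
  strict sublevel set, and not merely in its closure, is what makes it a local minimum.
\<close>

lemma eventually_local_minimum_in_clopen_piece:
  assumes fin: "\<forall>x\<in>topspace X. \<Psi> x \<noteq> -\<infinity>"
    and K: "compactin X K" "first_countable (subtopology X K)"
    and CK: "X closure_of strict_sublevel X \<Psi> \<rho> \<subseteq> K"
    and bdd: "bdd_below (\<Phi> ` K)"
    and lsc: "\<forall>\<^sub>F l in at_right (0::real). seq_lower_semicontinuous X (\<lambda>x. \<Psi> x + ereal (l * \<Phi> x))"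
    and U: "openin (subtopology X (X closure_of strict_sublevel X \<Psi> \<rho>)) U"
      "closedin (subtopology X (X closure_of strict_sublevel X \<Psi> \<rho>)) U" "U \<noteq> {}"
  shows "\<forall>\<^sub>F l in at_right 0. \<exists>x\<in>U. x \<in> strict_sublevel X \<Psi> \<rho> \<and>
           local_minimum (sublevel_topology X \<Psi>) (\<lambda>x. \<Psi> x + ereal (l * \<Phi> x)) x"
proof -
  let ?S = "strict_sublevel X \<Psi> \<rho>"
  let ?C = "X closure_of ?S"
  obtain T where T: "openin X T" "U = T \<inter> ?C"
    using U(1) by (auto simp: openin_subtopology)
  have "closedin X U"
    using U(2) by (meson closedin_closure_of closedin_trans_full)
  moreover have UK: "U \<subseteq> K" using T(2) CK by blast
  ultimately have Ucomp: "compactin X U"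
    using K(1) closed_compactin by blast
  have "subtopology X U = subtopology (subtopology X K) U"
    using UK by (simp add: subtopology_subtopology inf.absorb2)
  then have Ufc: "first_countable (subtopology X U)"
    using first_countable_subtopology[OF K(2)] by simp
  \<comment> \<open>The sublevel set is dense in its closure, so it meets the relatively open piece.\<close>
  obtain a where a: "a \<in> U" "a \<in> ?S"
    using U(3) T in_closure_of[of _ X ?S] closure_of_subset[of ?S X]
    unfolding T(2) strict_sublevel_def by blast
  obtain p where p: "\<Psi> a = ereal p" "p < \<rho>"
    using a(2) fin by (cases "\<Psi> a") (auto simp: strict_sublevel_def)
  obtain m where m: "\<And>x. x \<in> K \<Longrightarrow> m \<le> \<Phi> x"
    using bdd by (auto simp: bdd_below_def)
  have open_piece: "openin (sublevel_topology X \<Psi>) (T \<inter> ?S)"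
    unfolding sublevel_topology_def
    by (intro openin_Int topology_generated_by_Basis) (use T(1) in auto)
  \<comment> \<open>This expression bounds \<open>\<Psi>\<close> at a minimum point over \<open>U\<close>, by comparison with \<open>a\<close>.\<close>
  have "((\<lambda>l. p + l * (\<Phi> a - m)) \<longlongrightarrow> p + 0 * (\<Phi> a - m)) (at_right 0)"
    by (intro tendsto_intros)
  then have small: "\<forall>\<^sub>F l in at_right 0. p + l * (\<Phi> a - m) < \<rho>"
    using p(2) by (intro order_tendstoD(2)) auto
  have pos: "\<forall>\<^sub>F l in at_right (0::real). 0 < l"
    by (simp add: eventually_at_right_less)
  show ?thesis
    using lsc small pos
  proof eventually_elim
    case (elim l)
    let ?F = "\<lambda>x. \<Psi> x + ereal (l * \<Phi> x)"
    obtain x where x: "x \<in> U" "\<And>y. y \<in> U \<Longrightarrow> ?F x \<le> ?F y"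
      using seq_lsc_attains_minimum[OF Ucomp Ufc U(3) elim(1)] by blast
    have xX: "x \<in> topspace X"
      using x(1) compactin_subset_topspace[OF Ucomp] by blast
    have "?F x \<le> ereal (p + l * \<Phi> a)"
      using x(2)[OF a(1)] p(1) by simp
    moreover have "l * m \<le> l * \<Phi> x"
      using m x(1) UK \<open>0 < l\<close> by (intro mult_left_mono) auto
    ultimately have "\<Psi> x < ereal \<rho>"
      using elim(2) by (cases "\<Psi> x") (auto simp: algebra_simps)
    then have xS: "x \<in> ?S" using xX by (simp add: strict_sublevel_def)
    have "T \<inter> ?S \<subseteq> U"
      using T(2) closure_of_subset[of ?S X] by (auto simp: strict_sublevel_def)
    then have "local_minimum (sublevel_topology X \<Psi>) ?F x"
      unfolding local_minimum_def using open_piece x xS T(2) by blast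
    then show ?case using x(1) xS by blast
  qed
qed

text \<open>
  The pieces are finitely many, so a single \<open>\<mu> n\<close> is small enough for all of them; disjointness
  makes the local minima found in them distinct.
\<close>

lemma card_open_partition_le_local_minima:
  assumes fin: "\<forall>x\<in>topspace X. \<Psi> x \<noteq> -\<infinity>"
    and K: "compactin X K" "first_countable (subtopology X K)"
    and CK: "X closure_of strict_sublevel X \<Psi> \<rho> \<subseteq> K"
    and bdd: "bdd_below (\<Phi> ` K)"
    and lsc: "\<forall>\<^sub>F l in at_right (0::real). seq_lower_semicontinuous X (\<lambda>x. \<Psi> x + ereal (l * \<Phi> x))"
    and \<mu>: "\<forall>n::nat. \<mu> n > 0" "\<mu> \<longlonglongrightarrow> 0"
    and few: "\<forall>n. has_at_most k
           {x \<in> strict_sublevel X \<Psi> \<rho>.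
              local_minimum (sublevel_topology X \<Psi>) (\<lambda>x. \<Psi> x + ereal (\<mu> n * \<Phi> x)) x}"
    and P: "open_partition (subtopology X (X closure_of strict_sublevel X \<Psi> \<rho>)) P"
  shows "card P \<le> k"
proof -
  let ?min = "\<lambda>l. {x \<in> strict_sublevel X \<Psi> \<rho>.
    local_minimum (sublevel_topology X \<Psi>) (\<lambda>x. \<Psi> x + ereal (l * \<Phi> x)) x}"
  have "finite P" and disj: "disjoint P"
    using P by (auto simp: open_partition_def)
  have "\<forall>\<^sub>F l in at_right 0. \<exists>x\<in>U. x \<in> ?min l" if "U \<in> P" for U
    using eventually_local_minimum_in_clopen_piece[OF fin K CK bdd lsc, of U]
      P that open_partition_clopen[OF P that] by (simp add: open_partition_def)
  then have "\<forall>\<^sub>F l in at_right 0. \<forall>U\<in>P. \<exists>x\<in>U. x \<in> ?min l"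
    using \<open>finite P\<close> by (simp add: eventually_ball_finite)
  moreover have "filterlim \<mu> (at_right 0) sequentially"
    using \<mu> by (intro tendsto_imp_filterlim_at_right) auto
  ultimately have "\<forall>\<^sub>F n in sequentially. \<forall>U\<in>P. \<exists>x\<in>U. x \<in> ?min (\<mu> n)"
    by (rule eventually_compose_filterlim)
  then obtain n where "\<forall>U\<in>P. \<exists>x\<in>U. x \<in> ?min (\<mu> n)"
    using eventually_happens'[OF sequentially_bot] by blast
  then obtain g where g: "\<And>U. U \<in> P \<Longrightarrow> g U \<in> U" "\<And>U. U \<in> P \<Longrightarrow> g U \<in> ?min (\<mu> n)"
    by metis
  have "inj_on g P"
    using g(1) disj unfolding inj_on_def disjoint_def by (metis disjoint_iff)
  then have "card P \<le> card (?min (\<mu> n))"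
    using g(2) few by (intro card_inj_on_le[of g]) (auto simp: has_at_most_def)
  then show ?thesis
    using few unfolding has_at_most_def by (meson order_trans)
qed

section \<open>Components of sublevel sets and of the set of minimizers\<close>

theorem theorem3:
  fixes X :: "'a topology" and k :: nat and \<Psi> :: "'a \<Rightarrow> ereal" and r :: real
    and \<Phi> :: "'a \<Rightarrow> real" and \<mu> :: "nat \<Rightarrow> real"
  assumes "Hausdorff_space X"
    and "k > 0"
    and "\<forall>x\<in>topspace X. \<Psi> x \<noteq> -\<infinity>"
    and "seq_lower_semicontinuous X \<Psi>"
    and "(INF x\<in>topspace X. \<Psi> x) < ereal r"
    and "compactin X (X closure_of strict_sublevel X \<Psi> r)"
    and "first_countable (subtopology X (X closure_of strict_sublevel X \<Psi> r))"
    and "bdd_below (\<Phi> ` (X closure_of strict_sublevel X \<Psi> r))"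
    and "\<forall>n. \<mu> n > 0"
    and "\<mu> \<longlonglongrightarrow> 0"
    and "\<exists>l0>0. \<forall>l::real. 0 < l \<and> l \<le> l0 \<longrightarrow>
           seq_lower_semicontinuous X (\<lambda>x. \<Psi> x + ereal (l * \<Phi> x))"
    and "\<forall>n. has_at_most k
           {x \<in> strict_sublevel X \<Psi> r.
              local_minimum (sublevel_topology X \<Psi>) (\<lambda>x. \<Psi> x + ereal (\<mu> n * \<Phi> x)) x}"
  shows "(\<forall>\<rho>::real. (INF x\<in>topspace X. \<Psi> x) < ereal \<rho> \<and> \<rho> \<le> r \<longrightarrow>
            has_at_most k (connected_components_of
              (subtopology X (X closure_of strict_sublevel X \<Psi> \<rho>))) \<and>
            (k = 1 \<longrightarrow> connectedin X (X closure_of strict_sublevel X \<Psi> \<rho>))) \<and>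
         has_at_most k (connected_components_of
           (subtopology X {x \<in> topspace X. \<Psi> x = (INF y\<in>topspace X. \<Psi> y)})) \<and>
         (k = 1 \<longrightarrow> connectedin X {x \<in> topspace X. \<Psi> x = (INF y\<in>topspace X. \<Psi> y)})"
proof -
  let ?S = "strict_sublevel X \<Psi>"
  let ?C = "\<lambda>\<rho>. X closure_of ?S \<rho>"
  let ?inf = "INF x\<in>topspace X. \<Psi> x"
  let ?M = "{x \<in> topspace X. \<Psi> x = ?inf}"
  let ?min = "\<lambda>\<rho> n. {x \<in> ?S \<rho>.
    local_minimum (sublevel_topology X \<Psi>) (\<lambda>x. \<Psi> x + ereal (\<mu> n * \<Phi> x)) x}"
  note T2 = assms(1) and fin = assms(3) and lsc = assms(4) and K = assms(6,7)
  have lsc_pert: "\<forall>\<^sub>F l in at_right (0::real). seq_lower_semicontinuous X (\<lambda>x. \<Psi> x + ereal (l * \<Phi> x))"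
    using assms(11) unfolding eventually_at_right_field by (metis less_imp_le)
  have mono: "?S \<rho> \<subseteq> ?S r" if "\<rho> \<le> r" for \<rho>
    using that by (auto simp: strict_sublevel_def intro: less_le_trans)
  have card_le: "card P \<le> k" if "\<rho> \<le> r" and P: "open_partition (subtopology X (?C \<rho>)) P" for \<rho> P
  proof (rule card_open_partition_le_local_minima[OF fin K closure_of_mono[OF mono[OF that(1)]]
        assms(8) lsc_pert assms(9,10) _ P])
    have "?min \<rho> n \<subseteq> ?min r n" for n
      using mono[OF that(1)] by blast
    then show "\<forall>n. has_at_most k (?min \<rho> n)"
      using assms(12) unfolding has_at_most_def by (meson card_mono finite_subset order_trans)
  qed
  have sublevels: "has_at_most k (connected_components_of (subtopology X (?C \<rho>)))"
    if "\<rho> \<le> r" for \<rho>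
    using card_le[OF that] many_components_imp_open_partition by (metis Suc_n_not_le_n)
  have minimizers: "has_at_most k (connected_components_of (subtopology X ?M))"
  proof (rule ccontr)
    assume "\<not> ?thesis"
    then obtain P where P: "open_partition (subtopology X ?M) P" "card P = Suc k"
      using many_components_imp_open_partition by blast
    \<comment> \<open>A minimizer exists because the partition has a piece; its value shows that the infimum
      is a real number.\<close>
    then have "?M \<noteq> {}"
      by (force simp: open_partition_def)
    then obtain x where "x \<in> topspace X" "\<Psi> x = ?inf" by blast
    then obtain m where m: "?inf = ereal m"
      using fin assms(5) by (cases "?inf") auto
    then have "m < r" using assms(5) by simp
    have "?M = {x \<in> topspace X. \<Psi> x \<le> ereal m}"
      using m INF_lower[of _ "topspace X" \<Psi>] by (auto intro: antisym)
    then obtain \<rho> Q where "\<rho> \<le> r" "card Q = card P" "open_partition (subtopology X (?C \<rho>)) Q"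
      using open_partition_extends_to_sublevel[OF T2 lsc \<open>m < r\<close> K] P(1) by metis
    then show False
      using card_le P(2) by fastforce
  qed
  show ?thesis
    using sublevels minimizers
    by (auto intro!: has_at_most_one_component_imp_connectedin closure_of_subset_topspace
        simp: closure_of_subset_topspace)
qed

end
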